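(* Let $n\ge 4$ be an integer, let $\Sigma$ be a finite alphabet of size at least $2$, and let $h:\Sigma^*\to\Sigma^*$ be a morphism. Let $G_h$ be the subgroup of $\mathbb{Z}^{\Sigma}$ generated by $\psi(h(\Sigma))=\{\psi(h(\sigma)):\sigma\in\Sigma\}$. For $e\in\mathbb{Z}^\Sigma$ let $\overline{e}\in\mathbb{Z}^{\Sigma}/G_h$ denote its class modulo $G_h$. Let $\mathcal{P}=\psi(\operatorname{Pref}(h))$ and $\overline{\mathcal{P}}=\{\overline{v}:v\in\mathcal{P}\}\subseteq \mathbb{Z}^\Sigma/G_h$. Suppose that the following conditions hold: (O1) The frequency matrix of $h$ is non-singular. (O2) $\operatorname{a-rk}(\overline{\mathcal{P}})\le n$. (O3) For every $v\in\mathcal{P}\setminus(\psi(h(\Sigma))\cup\{0\})$, the equivalence class $[v]_{\mathcal{P}}=\{w\in\mathcal{P}: w-v\in G_h\}$ contains at most $2$ elements, and the Parikh vector of a non-empty proper prefix of $h$ (that is, of a non-empty proper prefix of $h(\sigma)$ for some $\sigma\in\Sigma$) is not in the equivalence class of the zero vector $0\in\mathbb{Z}^\Sigma$ modulo $G_h$. Moreover, if $[v]_{\mathcal{P}}=\{v,w\}$ with $v\ne w$, then $v-w=\psi(h(p))-\psi(h(q))$ for unique $p,q\in\Sigma$ where $v\in\psi(\operatorname{Pref}(h(p)))$ and $w\in\psi(\operatorname{Pref}(h(q)))$. Then $h$ is an abelian $n$-power free morphism.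
   Context: $\Sigma^*$ is the free monoid of finite words over $\Sigma=\{\sigma_1,\dots,\sigma_m\}$, with empty word $\epsilon$; $\mathbb{Z}^\Sigma$ is the free $\mathbb{Z}$-module on $\Sigma$. A morphism $h:\Sigma^*\to\Sigma^*$ is a monoid homomorphism. The Parikh vector $\psi(u)\in\mathbb{N}^m\subset\mathbb{Z}^\Sigma$ of a word $u$ has $i$-th coordinate the number of occurrences of $\sigma_i$ in $u$. For a set of words $S$, $\psi(S)=\{\psi(u):u\in S\}$. The frequency matrix of $h$ is the $m\times m$ matrix whose $i$-th row is $\psi(h(\sigma_i))$. $\operatorname{Pref}(u)$ is the set of all prefixes of $u$ (including $\epsilon$ and $u$), and $\operatorname{Pref}(h)=\bigcup_{\sigma\in\Sigma}\operatorname{Pref}(h(\sigma))$. For an abelian group $G$ an arithmetic progression of length $k$ in $G$ is a sequence $a,a+d,\dots,a+(k-1)d$ with $a,d\in G$; it is trivial if $d=0$. For $A\subseteq G$, $\operatorname{a-rk}(A)$ is the length of a longest non-trivial arithmetic progression all of whose terms lie in $A$ (terms may repeat), and $\operatorname{a-rk}(A)=\infty$ if these lengths are unbounded. A word $u$ (finite or infinite) is abelian $k$-power free if whenever $u=xv_1\cdots v_ky$ with $\psi(v_1)=\cdots=\psi(v_k)$, one has $v_1=\cdots=v_k=\epsilon$. A morphism $h$ is abelian $n$-power free if $h(u)$ is abelian $n$-power free for every abelian $n$-power free word $u$. *)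

theory Defs
  imports
    "HOL-Analysis.Determinants"
    "HOL-Algebra.Coset"
    "HOL-Algebra.Generated_Groups"
    "HOL-Library.Extended_Nat"
    "HOL-Library.Sublist"
    "HOL-Library.Stream"
begin

text \<open>
  The alphabet is a finite type \<open>'a\<close>, finite words are lists over \<open>'a\<close>, infinite words are
  streams, and the free module on the alphabet is \<open>int ^ 'a\<close>.
\<close>

definition word_morphism :: "('a list \<Rightarrow> 'a list) \<Rightarrow> bool" where
  "word_morphism h \<longleftrightarrow> h [] = [] \<and> (\<forall>u v. h (u @ v) = h u @ h v)"

definition parikh :: "'a::finite list \<Rightarrow> int ^ 'a" where
  "parikh u = (\<chi> a. int (count_list u a))"

text \<open>
  The entries are integers, so non-singularity is \<open>det \<noteq> 0\<close>; \<open>invertible\<close> over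
  \<open>int\<close> would mean unimodular.
\<close>

definition frequency_matrix :: "('a::finite list \<Rightarrow> 'a list) \<Rightarrow> int ^ 'a ^ 'a" where
  "frequency_matrix h = (\<chi> a. parikh (h [a]))"

definition Pref :: "'a list \<Rightarrow> 'a list set" where
  "Pref u = {p. prefix p u}"

definition Pref_morphism :: "('a list \<Rightarrow> 'a list) \<Rightarrow> 'a list set" where
  "Pref_morphism h = (\<Union>a. Pref (h [a]))"

definition parikh_prefixes :: "('a::finite list \<Rightarrow> 'a list) \<Rightarrow> (int ^ 'a) set" where
  "parikh_prefixes h = parikh ` Pref_morphism h"

definition parikh_letters :: "('a::finite list \<Rightarrow> 'a list) \<Rightarrow> (int ^ 'a) set" where
  "parikh_letters h = range (\<lambda>a. parikh (h [a]))"

definition free_module :: "(int ^ 'a::finite) monoid" where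
  "free_module = \<lparr>carrier = UNIV, monoid.mult = (+), one = 0\<rparr>"

definition image_subgroup :: "('a::finite list \<Rightarrow> 'a list) \<Rightarrow> (int ^ 'a) set" where
  "image_subgroup h = generate free_module (parikh_letters h)"

definition residue_class :: "('a::finite list \<Rightarrow> 'a list) \<Rightarrow> int ^ 'a \<Rightarrow> (int ^ 'a) set" where
  "residue_class h e = image_subgroup h #>\<^bsub>free_module\<^esub> e"

definition prefix_class :: "('a::finite list \<Rightarrow> 'a list) \<Rightarrow> int ^ 'a \<Rightarrow> (int ^ 'a) set" where
  "prefix_class h v = {w \<in> parikh_prefixes h. w - v \<in> image_subgroup h}"

text \<open>
  The progression of length \<open>k\<close> is indexed by \<open>i < k\<close> and need not be injective, so the rank
  is \<open>\<infinity>\<close> as soon as \<open>A\<close> contains a coset of a nontrivial finite cyclic subgroup.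
\<close>

definition arith_rank :: "('g, 'b) monoid_scheme \<Rightarrow> 'g set \<Rightarrow> enat" where
  "arith_rank G A =
     (SUP k \<in> {k. \<exists>a\<in>carrier G. \<exists>d\<in>carrier G. d \<noteq> \<one>\<^bsub>G\<^esub> \<and>
                   (\<forall>i<k. a \<otimes>\<^bsub>G\<^esub> d [^]\<^bsub>G\<^esub> (i::nat) \<in> A)}. enat k)"

definition abelian_power_free :: "nat \<Rightarrow> 'a::finite list \<Rightarrow> bool" where
  "abelian_power_free k u \<longleftrightarrow>
     (\<forall>x vs y. u = x @ concat vs @ y \<and> length vs = k \<and>
        (\<forall>v\<in>set vs. \<forall>w\<in>set vs. parikh v = parikh w) \<longrightarrow> (\<forall>v\<in>set vs. v = []))"

definition abelian_power_free_stream :: "nat \<Rightarrow> 'a::finite stream \<Rightarrow> bool" where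
  "abelian_power_free_stream k s \<longleftrightarrow>
     (\<forall>x vs y. s = x @- concat vs @- y \<and> length vs = k \<and>
        (\<forall>v\<in>set vs. \<forall>w\<in>set vs. parikh v = parikh w) \<longrightarrow> (\<forall>v\<in>set vs. v = []))"

text \<open>
  The infinite word \<open>t\<close> is the image of the infinite word \<open>s\<close>: the images of the finite
  prefixes of \<open>s\<close> are prefixes of \<open>t\<close> of unbounded length. If these lengths are bounded,
  the image of \<open>s\<close> is the finite word \<open>h (stake k s)\<close> for large \<open>k\<close>.
\<close>

definition stream_image :: "('a list \<Rightarrow> 'a list) \<Rightarrow> 'a stream \<Rightarrow> 'a stream \<Rightarrow> bool" where
  "stream_image h s t \<longleftrightarrow>
     (\<forall>k. \<exists>t'. t = h (stake k s) @- t') \<and> (\<forall>N. \<exists>k. N \<le> length (h (stake k s)))"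

text \<open>
  Both finite and infinite words are covered. An infinite word with finite image needs no clause
  of its own, because its image is that of one of its finite prefixes.
\<close>

definition abelian_power_free_morphism :: "nat \<Rightarrow> ('a::finite list \<Rightarrow> 'a list) \<Rightarrow> bool" where
  "abelian_power_free_morphism n h \<longleftrightarrow>
     (\<forall>u. abelian_power_free n u \<longrightarrow> abelian_power_free n (h u)) \<and>
     (\<forall>s t. abelian_power_free_stream n s \<and> stream_image h s t \<longrightarrow> abelian_power_free_stream n t)"

end

theory Submission
  imports Defs
begin

text \<open>
  Cut \<open>h u\<close> at the \<open>n + 1\<close> borders of an abelian \<open>n\<close>-power. Each border leaves a remainder
  \<open>p\<^sub>i\<close>, a proper prefix of some \<open>h [a\<^sub>i]\<close>, and modulo \<open>G\<^sub>h\<close> the Parikh vectors of the remainders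
  form an arithmetic progression of length \<open>n + 1\<close>. By (O2) it is constant. By (O3), either all
  remainders are empty, or they all have the same Parikh vector, or the vector
  \<open>\<psi>(p\<^sub>i) - \<psi>(h [a\<^sub>i])\<close> does not depend on \<open>i\<close>. In each case, moving every border left to the
  beginning of its block or, in the last case, right to the end of its block yields cuts that come
  from \<open>u\<close> and still have equidistant Parikh vectors; by (O1) they bound an abelian \<open>n\<close>-power
  in \<open>u\<close>.
\<close>

section \<open>Parikh vectors and the frequency matrix\<close>

lemma parikh_Nil [simp]: "parikh [] = 0"
  by (simp add: parikh_def vec_eq_iff)

lemma parikh_append [simp]: "parikh (u @ v) = parikh u + parikh v"
  by (simp add: parikh_def vec_eq_iff)

lemma parikh_eq_0_iff [simp]: "parikh u = 0 \<longleftrightarrow> u = []"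
proof
  assume "parikh u = 0"
  then have "count_list u a = 0" for a
    by (simp add: parikh_def vec_eq_iff)
  then have "a \<notin> set u" for a
    by (simp add: count_list_0_iff)
  then show "u = []"
    by (metis last_in_set)
qed simp

lemma word_morphism_Nil: "word_morphism h \<Longrightarrow> h [] = []"
  by (simp add: word_morphism_def)

lemma word_morphism_append: "word_morphism h \<Longrightarrow> h (u @ v) = h u @ h v"
  by (simp add: word_morphism_def)

lemma word_morphism_take:
  assumes "word_morphism h" "i \<le> j"
  shows "h (take j u) = h (take i u) @ h (take (j - i) (drop i u))"
  using assms by (metis word_morphism_append take_add le_add_diff_inverse)

text \<open>Both sides are additive in the word, and on a single letter the Parikh vector is a unit
  vector, which picks out a row of the matrix. Letters index rows, hence the row-vector product
  \<open>v*\<close>.\<close>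

lemma parikh_word_morphism:
  assumes "word_morphism h"
  shows "parikh (h u) = parikh u v* frequency_matrix h"
proof (induction u)
  case Nil
  then show ?case
    using assms by (simp add: word_morphism_Nil)
next
  case (Cons a u)
  have *: "parikh [a] = axis a 1"
    by (auto simp: parikh_def vec_eq_iff axis_def)
  have **: "axis a 1 v* frequency_matrix h = parikh (h [a])"
    by (simp add: vec_eq_iff vector_matrix_mult_def frequency_matrix_def axis_def
        if_distrib if_distribR cong: if_cong)
  have "parikh (h ([a] @ u)) = (parikh [a] + parikh u) v* frequency_matrix h"
    using Cons assms unfolding word_morphism_append[OF assms] parikh_append
    by (simp add: vector_matrix_left_distrib * **)
  then show ?case
    by (metis append_Cons append_Nil parikh_append)
qed

lemma of_int_det:
  "of_int (det A) = (det (\<chi> i j. of_int (A $ i $ j)) :: 'b::comm_ring_1)"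
  by (simp add: det_def)

text \<open>A non-zero determinant need not be a unit over the integers, so the difference of the
  two vectors is moved to the reals, where the matrix has an inverse.\<close>

lemma vector_matrix_mult_int_cancel:
  fixes A :: "int ^ 'n ^ 'n"
  assumes "det A \<noteq> 0" and "x v* A = y v* A"
  shows "x = y"
proof -
  define B :: "real ^ 'n ^ 'n" where "B = (\<chi> i j. of_int (A $ i $ j))"
  define z :: "real ^ 'n" where "z = (\<chi> i. of_int (x $ i - y $ i))"
  have "det B = of_int (det A)"
    by (simp add: B_def of_int_det)
  then have "invertible B"
    using assms(1) by (simp add: invertible_det_nz)
  then obtain C where C: "B ** C = mat 1"
    by (auto simp: invertible_def)
  have "z v* B = 0"
  proof -
    have "(\<Sum>i\<in>UNIV. A $ i $ j * x $ i) = (\<Sum>i\<in>UNIV. A $ i $ j * y $ i)" for j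
      using assms(2) by (simp add: vec_eq_iff vector_matrix_mult_def mult.commute)
    then have "(\<Sum>i\<in>UNIV. A $ i $ j * (x $ i - y $ i)) = 0" for j
      by (simp add: right_diff_distrib sum_subtractf)
    then have "real_of_int (\<Sum>i\<in>UNIV. A $ i $ j * (x $ i - y $ i)) = 0" for j
      by simp
    then show ?thesis
      by (simp add: vec_eq_iff vector_matrix_mult_def z_def B_def mult.commute)
  qed
  then have "z v* (B ** C) = 0"
    by (metis vector_matrix_mul_assoc vector_matrix_mult_0)
  then have "z = 0"
    by (simp add: C)
  then show ?thesis
    by (simp add: z_def vec_eq_iff)
qed

text \<open>The form in which (O1) is used: abelian equivalence of images pulls back to abelian
  equivalence of the words.\<close>

lemma parikh_word_morphism_cancel:
  assumes "word_morphism h" "det (frequency_matrix h) \<noteq> 0" "parikh (h u) = parikh (h v)"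
  shows "parikh u = parikh v"
  using assms by (simp add: parikh_word_morphism vector_matrix_mult_int_cancel)

section \<open>The subgroup \<open>image_subgroup h\<close> and its cosets\<close>

lemma free_module_simps [simp]:
  "carrier free_module = UNIV" "x \<otimes>\<^bsub>free_module\<^esub> y = x + y" "\<one>\<^bsub>free_module\<^esub> = 0"
  by (simp_all add: free_module_def)

lemma comm_group_free_module: "comm_group free_module"
  by (rule comm_groupI) (auto simp: algebra_simps intro: exI[of _ "- x" for x])

lemma inv_free_module [simp]: "inv\<^bsub>free_module\<^esub> x = - x"
  using comm_group.axioms(2)[OF comm_group_free_module]
  by (intro group.inv_equality) auto

lemma image_subgroup_subgroup: "subgroup (image_subgroup h) free_module"
  unfolding image_subgroup_def using comm_group.axioms(2)[OF comm_group_free_module]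
  by (intro group.generate_is_subgroup) auto

lemma image_subgroup_normal: "image_subgroup h \<lhd> free_module"
  using comm_group_free_module image_subgroup_subgroup
  by (rule comm_group.subgroup_imp_normal)

lemma zero_in_image_subgroup: "0 \<in> image_subgroup h"
  using subgroup.one_closed[OF image_subgroup_subgroup, of h] by simp

lemma add_in_image_subgroup:
  "x \<in> image_subgroup h \<Longrightarrow> y \<in> image_subgroup h \<Longrightarrow> x + y \<in> image_subgroup h"
  using subgroup.m_closed[OF image_subgroup_subgroup, of x h y] by simp

lemma uminus_in_image_subgroup: "x \<in> image_subgroup h \<Longrightarrow> - x \<in> image_subgroup h"
  using subgroup.m_inv_closed[OF image_subgroup_subgroup, of x h] by simp

lemma diff_in_image_subgroup:
  "x \<in> image_subgroup h \<Longrightarrow> y \<in> image_subgroup h \<Longrightarrow> x - y \<in> image_subgroup h"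
  using add_in_image_subgroup[of x h "- y"] uminus_in_image_subgroup[of y h] by simp

lemma parikh_letters_subset: "parikh_letters h \<subseteq> image_subgroup h"
  by (auto simp: image_subgroup_def intro: generate.incl)

lemma parikh_morphism_in_image_subgroup:
  assumes "word_morphism h"
  shows "parikh (h u) \<in> image_subgroup h"
proof (induction u)
  case Nil
  then show ?case
    using assms by (simp add: word_morphism_Nil zero_in_image_subgroup)
next
  case (Cons a u)
  have "parikh (h [a]) \<in> image_subgroup h"
    using parikh_letters_subset by (auto simp: parikh_letters_def)
  then show ?case
    using Cons word_morphism_append[OF assms, of "[a]" u] by (simp add: add_in_image_subgroup)
qed

lemma in_residue_class_iff: "x \<in> residue_class h e \<longleftrightarrow> x - e \<in> image_subgroup h"
  by (auto simp: residue_class_def r_coset_def intro!: bexI[of _ "x - e"])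

lemma residue_class_eq_iff: "residue_class h x = residue_class h y \<longleftrightarrow> x - y \<in> image_subgroup h"
proof
  assume "residue_class h x = residue_class h y"
  then show "x - y \<in> image_subgroup h"
    using zero_in_image_subgroup[of h] in_residue_class_iff[of x h x] in_residue_class_iff[of x h y]
    by simp
next
  assume xy: "x - y \<in> image_subgroup h"
  have "z - x \<in> image_subgroup h \<longleftrightarrow> z - y \<in> image_subgroup h" for z
    using add_in_image_subgroup[OF _ xy, of "z - x"] diff_in_image_subgroup[OF _ xy, of "z - y"]
    by (auto simp: algebra_simps)
  then show "residue_class h x = residue_class h y"
    by (auto simp: in_residue_class_iff)
qed

lemma residue_class_hom: "residue_class h \<in> hom free_module (free_module Mod image_subgroup h)"
  unfolding residue_class_def by (rule normal.r_coset_hom_Mod[OF image_subgroup_normal])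

lemma residue_class_one: "\<one>\<^bsub>free_module Mod image_subgroup h\<^esub> = residue_class h 0"
  by (auto simp: FactGroup_def in_residue_class_iff)

section \<open>Arithmetic progressions in the quotient\<close>

lemma arith_rank_ge:
  assumes "a \<in> carrier G" "d \<in> carrier G" "d \<noteq> \<one>\<^bsub>G\<^esub>"
    and "\<And>i. i < k \<Longrightarrow> a \<otimes>\<^bsub>G\<^esub> d [^]\<^bsub>G\<^esub> (i::nat) \<in> A"
  shows "enat k \<le> arith_rank G A"
  unfolding arith_rank_def using assms by (intro SUP_upper) blast

text \<open>If \<open>e\<close> were outside the subgroup, its class would be a non-trivial common
  difference, and the classes of \<open>f 0\<close>, ..., \<open>f n\<close> would form a
  progression of length \<open>n + 1\<close>, exceeding the rank bound.\<close>

lemma constant_difference_in_image_subgroup: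
  fixes f :: "nat \<Rightarrow> int ^ 'a::finite"
  assumes "arith_rank (free_module Mod image_subgroup h) A \<le> enat n"
    and step: "\<And>i. i < n \<Longrightarrow> f (Suc i) = f i + e"
    and mem: "\<And>i. i \<le> n \<Longrightarrow> residue_class h (f i) \<in> A"
  shows "e \<in> image_subgroup h"
proof (rule ccontr)
  assume e: "e \<notin> image_subgroup h"
  let ?Q = "free_module Mod image_subgroup h"
  interpret Q: group ?Q
    by (rule normal.factorgroup_is_group[OF image_subgroup_normal])
  have car: "residue_class h x \<in> carrier ?Q" for x
    using residue_class_hom by (auto simp: hom_def)
  have mult: "residue_class h (x + y) = residue_class h x \<otimes>\<^bsub>?Q\<^esub> residue_class h y" for x y
    using hom_mult[OF residue_class_hom, of x y h] by simp
  have prog: "residue_class h (f i)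
      = residue_class h (f 0) \<otimes>\<^bsub>?Q\<^esub> residue_class h e [^]\<^bsub>?Q\<^esub> i" if "i \<le> n" for i
    using that
  proof (induction i)
    case 0
    then show ?case
      using car Q.r_one by simp
  next
    case (Suc i)
    then show ?case
      using car by (simp add: step mult Q.m_assoc del: mult_FactGroup)
  qed
  have "enat (Suc n) \<le> arith_rank ?Q A"
  proof (rule arith_rank_ge)
    show "residue_class h e \<noteq> \<one>\<^bsub>?Q\<^esub>"
      using e residue_class_eq_iff[of h e 0] unfolding residue_class_one by simp
    show "residue_class h (f 0) \<otimes>\<^bsub>?Q\<^esub> residue_class h e [^]\<^bsub>?Q\<^esub> i \<in> A" if "i < Suc n" for i
      using that mem[of i] prog[of i] by simp
  qed (rule car)+
  then show False
    using assms(1) by (metis enat_ord_simps(1) not_less_eq_eq order_refl order_trans)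
qed

section \<open>Prefixes of images and cuts of words\<close>

lemma finite_parikh_prefixes: "finite (parikh_prefixes h)"
proof -
  have "Pref u = set (prefixes u)" for u :: "'a list"
    by (auto simp: Pref_def)
  then show ?thesis
    by (simp add: parikh_prefixes_def Pref_morphism_def)
qed

lemma parikh_prefixesI: "prefix p (h [a]) \<Longrightarrow> parikh p \<in> parikh_prefixes h"
  by (auto simp: parikh_prefixes_def Pref_morphism_def Pref_def)

text \<open>Complete blocks are stripped from \<open>z\<close> until a proper prefix of the next
  block remains or \<open>u\<close> is exhausted. Strictness also forces that next block to be
  non-empty, so letters erased by \<open>h\<close> are counted in \<open>j\<close>.\<close>

lemma prefix_morphism_cases:
  assumes "word_morphism h" "prefix z (h u)"
  obtains j p where "j \<le> length u" "z = h (take j u) @ p"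
    "j = length u \<Longrightarrow> p = []" "j < length u \<Longrightarrow> strict_prefix p (h [u ! j])"
proof -
  have "\<exists>j p. j \<le> length u \<and> z = h (take j u) @ p \<and> (j = length u \<longrightarrow> p = []) \<and>
      (j < length u \<longrightarrow> strict_prefix p (h [u ! j]))"
    using assms(2)
  proof (induction u arbitrary: z)
    case Nil
    then show ?case
      using assms(1) by (simp add: word_morphism_Nil)
  next
    case (Cons a u)
    have h_Cons: "h (a # v) = h [a] @ h v" for v
      using word_morphism_append[OF assms(1), of "[a]" v] by simp
    show ?case
    proof (cases "strict_prefix z (h [a])")
      case True
      then show ?thesis
        using assms(1) by (intro exI[of _ 0] exI[of _ z]) (simp add: word_morphism_Nil)
    next
      case False
      then obtain z' where z': "z = h [a] @ z'" "prefix z' (h u)"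
        using Cons.prems unfolding h_Cons[of u] prefix_append
        by (metis append_Nil2 prefix_order.le_neq_trans Nil_prefix)
      from Cons.IH[OF z'(2)] obtain j p where
        "j \<le> length u" "z' = h (take j u) @ p" "j = length u \<longrightarrow> p = []"
        "j < length u \<longrightarrow> strict_prefix p (h [u ! j])"
        by blast
      then show ?thesis
        by (intro exI[of _ "Suc j"] exI[of _ p]) (simp add: z' h_Cons[of "take j u"])
    qed
  qed
  then show ?thesis
    using that by blast
qed

text \<open>Were \<open>j' < j\<close>, then \<open>z\<close> would cover the whole block of the
  letter at \<open>j'\<close>, whereas \<open>z'\<close> stops strictly before the end of that block
  and is at least as long as \<open>z\<close>.\<close>

lemma prefix_morphism_cut_mono:
  assumes "word_morphism h"
    and z: "prefix z z'" "z = h (take j u) @ p" "z' = h (take j' u) @ p'"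
    and "j \<le> length u" "j' < length u \<Longrightarrow> strict_prefix p' (h [u ! j'])"
  shows "j \<le> j'"
proof (rule ccontr)
  assume "\<not> j \<le> j'"
  then have "j' < length u" "Suc j' \<le> j"
    using assms(5) by auto
  have "length z' < length (h (take j' u)) + length (h [u ! j'])"
    using assms(6) \<open>j' < length u\<close> by (simp add: z(3) prefix_length_less)
  also have "\<dots> = length (h (take (Suc j') u))"
    using \<open>j' < length u\<close> word_morphism_append[OF assms(1)]
    by (simp add: take_Suc_conv_app_nth)
  also have "\<dots> \<le> length (h (take j u))"
    using word_morphism_take[OF assms(1) \<open>Suc j' \<le> j\<close>, of u] by simp
  also have "\<dots> \<le> length z"
    by (simp add: z(2))
  also have "\<dots> \<le> length z'"
    using z(1) by (rule prefix_length_le)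
  finally show False
    by simp
qed

lemma concat_cuts:
  assumes "\<And>i. i < n \<Longrightarrow> j i \<le> j (Suc i)"
  shows "j 0 \<le> j n \<and> take (j 0) u @
    concat (map (\<lambda>i. take (j (Suc i) - j i) (drop (j i) u)) [0..<n]) = take (j n) u"
  using assms
proof (induction n)
  case (Suc n)
  then have "j 0 \<le> j n" and
    IH: "take (j 0) u @ concat (map (\<lambda>i. take (j (Suc i) - j i) (drop (j i) u)) [0..<n])
      = take (j n) u"
    by auto
  moreover have "j n \<le> j (Suc n)"
    using Suc.prems by simp
  moreover from this have "take (j n) u @ take (j (Suc n) - j n) (drop (j n) u) = take (j (Suc n)) u"
    by (metis take_add le_add_diff_inverse)
  ultimately show ?case
    by (simp add: IH[symmetric])
qed simp

text \<open>The factors of \<open>u\<close> between consecutive cuts have images with the common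
  Parikh vector \<open>e\<close>. By (O1) the factors themselves share a Parikh vector, so they form
  an abelian power in \<open>u\<close> and must be empty.\<close>

lemma abelian_power_free_equidistant_cuts:
  assumes "word_morphism h" "det (frequency_matrix h) \<noteq> 0" "abelian_power_free n u" "n > 0"
    and mono: "\<And>i. i < n \<Longrightarrow> j i \<le> j (Suc i)"
    and step: "\<And>i. i < n \<Longrightarrow> parikh (h (take (j (Suc i)) u)) = parikh (h (take (j i) u)) + e"
  shows "e = 0"
proof -
  define w where "w i = take (j (Suc i) - j i) (drop (j i) u)" for i
  have hw: "parikh (h (w i)) = e" if "i < n" for i
    using step[OF that] word_morphism_take[OF assms(1) mono[OF that], of u] by (simp add: w_def)
  have "u = take (j n) u @ drop (j n) u"
    by simp
  also have "take (j n) u = take (j 0) u @ concat (map w [0..<n])"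
    using concat_cuts[of n j u] mono by (simp add: w_def[abs_def])
  finally have u: "u = take (j 0) u @ concat (map w [0..<n]) @ drop (j n) u"
    by simp
  have "\<forall>v\<in>set (map w [0..<n]). \<forall>v'\<in>set (map w [0..<n]). parikh v = parikh v'"
    by (intro ballI, rule parikh_word_morphism_cancel[OF assms(1,2)]) (auto simp: hw)
  moreover have "length (map w [0..<n]) = n"
    by simp
  ultimately have "\<forall>v\<in>set (map w [0..<n]). v = []"
    using assms(3)[unfolded abelian_power_free_def] u by blast
  then have "w 0 = []"
    using assms(4) by simp
  then show ?thesis
    using hw[of 0] assms(1,4) by (simp add: word_morphism_Nil)
qed

section \<open>From finite to infinite words\<close>

lemma abelian_power_free_stake:
  assumes "abelian_power_free_stream n s"
  shows "abelian_power_free n (stake k s)"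
  unfolding abelian_power_free_def
proof (intro allI impI, elim conjE)
  fix x vs y
  assume "stake k s = x @ concat vs @ y" "length vs = n"
    "\<forall>v\<in>set vs. \<forall>w\<in>set vs. parikh v = parikh w"
  moreover from this have "s = x @- concat vs @- (y @- sdrop k s)"
    by (metis shift_append stake_sdrop)
  ultimately show "\<forall>v\<in>set vs. v = []"
    using assms unfolding abelian_power_free_stream_def by blast
qed

text \<open>A power in the infinite image already lies in the image of a long enough finite prefix
  of \<open>s\<close>, where the finite case applies.\<close>

lemma abelian_power_free_morphismI:
  fixes h :: "'a::finite list \<Rightarrow> 'a list"
  assumes fin: "\<And>u :: 'a list. abelian_power_free n u \<Longrightarrow> abelian_power_free n (h u)"
  shows "abelian_power_free_morphism n h"
  unfolding abelian_power_free_morphism_def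
proof (intro conjI allI impI)
  fix u :: "'a list" assume "abelian_power_free n u"
  then show "abelian_power_free n (h u)"
    by (rule fin)
next
  fix s t :: "'a stream"
  assume st: "abelian_power_free_stream n s \<and> stream_image h s t"
  show "abelian_power_free_stream n t"
    unfolding abelian_power_free_stream_def
  proof (intro allI impI, elim conjE)
    fix x vs y
    assume t: "t = x @- concat vs @- y"
      and vs: "length vs = n" "\<forall>v\<in>set vs. \<forall>w\<in>set vs. parikh v = parikh w"
    from st obtain k where k: "length (x @ concat vs) \<le> length (h (stake k s))"
      unfolding stream_image_def by blast
    from st obtain t' where t': "t = h (stake k s) @- t'"
      unfolding stream_image_def by blast
    \<comment> \<open>Both \<open>h (stake k s)\<close> and \<open>x @ concat vs\<close> are
      prefixes of \<open>t\<close>; by the choice of \<open>k\<close> the first is at least as long,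
      so it contains the whole power.\<close>
    have "h (stake k s) = stake (length (h (stake k s))) t"
      unfolding t' by (simp add: stake_shift)
    also have "t = (x @ concat vs) @- y"
      by (simp add: t)
    also have "stake (length (h (stake k s))) \<dots> = x @ concat vs @ stake (length (h (stake k s)) - length (x @ concat vs)) y"
      using k by (subst stake_shift) simp
    finally have "h (stake k s) = \<dots>" .
    moreover have "abelian_power_free n (h (stake k s))"
      using st by (intro fin abelian_power_free_stake) blast
    ultimately show "\<forall>v\<in>set vs. v = []"
      using vs unfolding abelian_power_free_def by blast
  qed
qed

section \<open>Remainder classes of size two and the finite case\<close>

lemma card_le_2_cases:
  assumes "finite S" "card S \<le> 2" "v \<in> S"
  obtains "S = {v}" | w where "v \<noteq> w" "S = {v, w}"
proof (cases "S = {v}")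
  case False
  then obtain w where w: "w \<in> S" "v \<noteq> w"
    using assms(3) by blast
  then have "{v, w} = S"
    using assms by (intro card_seteq) auto
  then show ?thesis
    using that w by blast
qed

theorem theorem2p9:
  fixes n :: nat and h :: "'a::finite list \<Rightarrow> 'a list"
  assumes "n \<ge> 4"
    and "CARD('a) \<ge> 2"
    and "word_morphism h"
    and O1: "det (frequency_matrix h) \<noteq> 0"
    and O2: "arith_rank (free_module Mod image_subgroup h)
               (residue_class h ` parikh_prefixes h) \<le> enat n"
    and O3_card: "\<And>v. v \<in> parikh_prefixes h - (parikh_letters h \<union> {0}) \<Longrightarrow>
               card (prefix_class h v) \<le> 2"
    and O3_zero: "\<And>a p. p \<noteq> [] \<Longrightarrow> strict_prefix p (h [a]) \<Longrightarrow>
               parikh p \<notin> residue_class h 0"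
    and O3_pair: "\<And>v w. v \<in> parikh_prefixes h - (parikh_letters h \<union> {0}) \<Longrightarrow>
               prefix_class h v = {v, w} \<Longrightarrow> v \<noteq> w \<Longrightarrow>
               \<exists>p q. v - w = parikh (h [p]) - parikh (h [q]) \<and>
                 v \<in> parikh ` Pref (h [p]) \<and> w \<in> parikh ` Pref (h [q]) \<and>
                 (\<forall>p' q'. v \<in> parikh ` Pref (h [p']) \<and> w \<in> parikh ` Pref (h [q'])
                    \<longrightarrow> p' = p \<and> q' = q)"
  shows "abelian_power_free_morphism n h"
proof (rule abelian_power_free_morphismI)
  note h = \<open>word_morphism h\<close>
  let ?G = "image_subgroup h"
  fix u :: "'a list"
  assume u: "abelian_power_free n u"
  show "abelian_power_free n (h u)"
    unfolding abelian_power_free_def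
  proof (intro allI impI, elim conjE)
    fix x vs y
    assume hu: "h u = x @ concat vs @ y" and len: "length vs = n"
      and eq: "\<forall>v\<in>set vs. \<forall>w\<in>set vs. parikh v = parikh w"
    define e where "e = parikh (vs ! 0)"
    \<comment> \<open>The prefix of \<open>h u\<close> ending at the border with index
      \<open>i\<close>, for \<open>i\<close> from \<open>0\<close> to \<open>n\<close>.\<close>
    define z where "z i = x @ concat (take i vs)" for i
    have e: "parikh v = e" if "v \<in> set vs" for v
    proof -
      have "vs ! 0 \<in> set vs"
        using len \<open>n \<ge> 4\<close> by (intro nth_mem) simp
      then show ?thesis
        unfolding e_def using eq that by blast
    qed
    have z_Suc: "z (Suc i) = z i @ vs ! i" if "i < n" for i
      using that len by (simp add: z_def take_Suc_conv_app_nth)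
    have z_step: "parikh (z (Suc i)) = parikh (z i) + e" if "i < n" for i
      using that len by (simp add: z_Suc e)
    have "prefix (z i) (h u)" for i
    proof -
      have "concat vs = concat (take i vs) @ concat (drop i vs)"
        by (metis append_take_drop_id concat_append)
      then show ?thesis
        by (simp add: hu z_def)
    qed
    then have "\<exists>j p. j \<le> length u \<and> z i = h (take j u) @ p \<and> (j = length u \<longrightarrow> p = []) \<and>
        (j < length u \<longrightarrow> strict_prefix p (h [u ! j]))" for i
      by (rule prefix_morphism_cases[OF h]) blast
    then obtain j p where j_le: "\<And>i. j i \<le> length u" and z: "\<And>i. z i = h (take (j i) u) @ p i"
      and p_Nil: "\<And>i. j i = length u \<Longrightarrow> p i = []"
      and p_strict: "\<And>i. j i < length u \<Longrightarrow> strict_prefix (p i) (h [u ! j i])"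
      by metis
    have j_mono: "j i \<le> j (Suc i)" if "i < n" for i
      by (rule prefix_morphism_cut_mono[OF h _ z[of i] z[of "Suc i"] j_le p_strict])
        (simp add: z_Suc[OF that])
    have p_P: "parikh (p i) \<in> parikh_prefixes h" for i
      using p_Nil[of i] p_strict[of i] j_le[of i] parikh_prefixesI[of "p i" h]
      by (cases "j i = length u") (auto simp: strict_prefix_def)
    have z_p: "parikh (z i) - parikh (p i) \<in> ?G" for i
      by (simp add: z parikh_morphism_in_image_subgroup[OF h])
    \<comment> \<open>Each border is congruent to its remainder, so the \<open>n + 1\<close> classes
      of the borders all lie in the set whose rank (O2) bounds.\<close>
    have eG: "e \<in> ?G"
    proof (rule constant_difference_in_image_subgroup[OF O2, of "\<lambda>i. parikh (z i)"])
      show "residue_class h (parikh (z i)) \<in> residue_class h ` parikh_prefixes h" for i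
        using z_p p_P by (intro image_eqI[of _ _ "parikh (p i)"]) (auto simp: residue_class_eq_iff)
    qed (rule z_step)
    have z0: "parikh (z i) - parikh (z 0) \<in> ?G" if "i \<le> n" for i
      using that
    proof (induction i)
      case (Suc i)
      then show ?case
        using add_in_image_subgroup[OF _ eG, of "parikh (z i) - parikh (z 0)"]
        by (simp add: z_step algebra_simps)
    qed (simp add: zero_in_image_subgroup)
    \<comment> \<open>Borders differ by multiples of \<open>e\<close>, hence are congruent, and so
      are the remainders.\<close>
    have p0: "parikh (p i) - parikh (p 0) \<in> ?G" if "i \<le> n" for i
      using add_in_image_subgroup[OF diff_in_image_subgroup[OF z0[OF that] z_p[of i]] z_p[of 0]]
      by (simp add: algebra_simps)
    have p_G: "p i = [] \<or> parikh (p i) \<notin> ?G" for i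
      using O3_zero[of "p i"] p_Nil[of i] p_strict[of i] j_le[of i]
      by (cases "j i = length u") (auto simp: in_residue_class_iff)
    have "e = 0"
    \<comment> \<open>The first case includes the one where all remainders are empty. Dropping
      remainders with the same Parikh vector keeps the cuts equidistant.\<close>
    proof (cases "\<forall>i\<le>n. parikh (p i) = parikh (p 0)")
      case True
      have "parikh (h (take (j i) u)) = parikh (z i) - parikh (p 0)" if "i \<le> n" for i
        unfolding z using True[rule_format, OF that] by simp
      then show ?thesis
        using j_mono z_step \<open>n \<ge> 4\<close>
        by (intro abelian_power_free_equidistant_cuts[OF h O1 u, of j]) auto
    next
      case False
      let ?v = "parikh (p 0)"
      \<comment> \<open>Otherwise all remainders lie in the subgroup, so by (O3) all are empty,
        which the present case excludes.\<close>
      have vG: "?v \<notin> ?G"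
      proof
        assume "?v \<in> ?G"
        then have "parikh (p i) \<in> ?G" if "i \<le> n" for i
          using add_in_image_subgroup[OF p0[OF that]] by fastforce
        then have "p i = []" if "i \<le> n" for i
          using p_G that by blast
        then show False
          using False by simp
      qed
      then have v: "?v \<in> parikh_prefixes h - (parikh_letters h \<union> {0})"
        using p_P parikh_letters_subset[of h] zero_in_image_subgroup[of h] by auto
      have p_class: "parikh (p i) \<in> prefix_class h ?v" if "i \<le> n" for i
        using p_P p0[OF that] by (simp add: prefix_class_def)
      have "finite (prefix_class h ?v)"
        by (rule finite_subset[OF _ finite_parikh_prefixes[of h]]) (auto simp: prefix_class_def)
      \<comment> \<open>Some remainder differs from \<open>p 0\<close> in its Parikh vector, so the
        class has exactly two elements.\<close>
      moreover have "prefix_class h ?v \<noteq> {?v}"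
      proof
        assume single: "prefix_class h ?v = {?v}"
        have "parikh (p i) = ?v" if "i \<le> n" for i
          using p_class[OF that] unfolding single by (rule singletonD)
        then show False
          using False by blast
      qed
      ultimately obtain w where w: "?v \<noteq> w" "prefix_class h ?v = {?v, w}"
        using O3_card[OF v] p_class[of 0] card_le_2_cases[of "prefix_class h ?v" ?v] by blast
      obtain a b where ab: "?v - w = parikh (h [a]) - parikh (h [b])"
        "?v \<in> parikh ` Pref (h [a])" "w \<in> parikh ` Pref (h [b])"
        and uniq: "\<And>a' b'. ?v \<in> parikh ` Pref (h [a']) \<Longrightarrow> w \<in> parikh ` Pref (h [b'])
          \<Longrightarrow> a' = a \<and> b' = b"
        using O3_pair[OF v w(2,1)] by blast
      \<comment> \<open>A border at the very end of \<open>h u\<close> has an empty remainder, which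
        would put \<open>?v\<close> into the subgroup. So every border has a block to be
        completed.\<close>
      have lt: "j i < length u" if "i \<le> n" for i
      proof (rule ccontr)
        assume "\<not> j i < length u"
        then have "p i = []"
          using j_le[of i] p_Nil[of i] by simp
        then have "- ?v \<in> ?G"
          using p0[OF that] by simp
        then show False
          using vG uminus_in_image_subgroup[of "- ?v" h] by simp
      qed
      \<comment> \<open>Uniqueness of the pair determines the cut letter: \<open>a\<close> if the
        remainder has vector \<open>?v\<close>, and \<open>b\<close> if it has vector
        \<open>w\<close>. The identity for \<open>?v - w\<close> then equates the two offsets to the
        block end.\<close>
      have shift: "parikh (p i) - parikh (h [u ! j i]) = ?v - parikh (h [a])" if "i \<le> n" for i
      proof -
        have mem: "parikh (p i) \<in> parikh ` Pref (h [u ! j i])"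
          using p_strict[OF lt[OF that]] by (auto simp: Pref_def strict_prefix_def)
        have "parikh (p i) = ?v \<or> parikh (p i) = w"
          using p_class[OF that] unfolding w(2) by blast
        then show ?thesis
        proof
          assume v: "parikh (p i) = ?v"
          have "u ! j i = a"
            using uniq[OF mem[unfolded v] ab(3)] ..
          then show ?thesis
            unfolding v by simp
        next
          assume w: "parikh (p i) = w"
          have "u ! j i = b"
            using uniq[OF ab(2) mem[unfolded w]] ..
          then show ?thesis
            unfolding w using ab(1) by (simp add: algebra_simps)
        qed
      qed
      \<comment> \<open>\<open>Suc\<close> moves each border right to the end of its block; the
        offset is independent of \<open>i\<close>, so the new cuts are again equidistant with
        difference \<open>e\<close>.\<close>
      have "parikh (h (take (Suc (j i)) u)) = parikh (z i) - (?v - parikh (h [a]))" if "i \<le> n" for i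
        using shift[OF that] lt[OF that]
        by (simp add: z take_Suc_conv_app_nth word_morphism_append[OF h] algebra_simps)
      then show ?thesis
        using j_mono z_step \<open>n \<ge> 4\<close>
        by (intro abelian_power_free_equidistant_cuts[OF h O1 u, of "\<lambda>i. Suc (j i)"]) auto
    qed
    then show "\<forall>v\<in>set vs. v = []"
      using e parikh_eq_0_iff by auto
  qed
qed

end
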